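(* Let $b\ge4$ be an integer and $\gamma>0$. Let $\epsilon_0\in(0,1)$ be sufficiently small that $\ln_b\frac1\epsilon>0$ for $0<\epsilon\le\epsilon_0$, and let $$\pi(\epsilon)=\frac{1}{\epsilon\,\bigl(\ln\frac1\epsilon\bigr)\bigl(\ln_2\frac1\epsilon\bigr)\cdots\bigl(\ln_{b-1}\frac1\epsilon\bigr)\bigl(\ln_b\frac1\epsilon\bigr)^{1+\gamma}},\qquad\epsilon\in(0,\epsilon_0),$$ with $\pi(\epsilon)=0$ elsewhere on $[0,1]$. For sufficiently large $\lambda$ let $$\psi(\lambda)=\sqrt{2\ln_2\lambda+3\ln_3\lambda+2\ln_4\lambda+\dots+2\ln_b\lambda+2(1+2\gamma)\ln_{b+1}\lambda}.$$ In the one-sided unbounded forecasting game, by the Bayesian strategy with prior density $\pi$, Skeptic weakly forces the event $$A_\infty=\infty\ \Longrightarrow\ S_n-A_n\psi(A_n^2)\le0\text{ for all but finitely many }n .$$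
   Context: $\ln_bx$ denotes the $b$-fold iterated logarithm $\ln\ln\cdots\ln x$ ($b$ times). One-sided unbounded forecasting game (OUFG). Skeptic starts with an initial capital $\mathcal K_0>0$. On each round $n=1,2,\dots$, Skeptic announces $M_n\in\mathbb R$, then Reality announces $x_n\in[-1,\infty)$, and $\mathcal K_n=\mathcal K_{n-1}+M_nx_n$. Skeptic must keep $\mathcal K_n\ge 0$ for all $n$ whatever Reality does. A path is an infinite sequence $(x_n)_{n\ge1}$ in $[-1,\infty)$; an event is a set of paths. A strategy of Skeptic ($M_n$ as a function of $x_1,\dots,x_{n-1}$, keeping the capital nonnegative on every path) weakly forces an event $E$ if $\limsup_n\mathcal K_n=\infty$ on every path not in $E$. The event "$P\Rightarrow Q$" is the set of paths for which $P$ fails or $Q$ holds. Notation: $S_n=x_1+\dots+x_n$, $A_n^2=x_1^2+\dots+x_n^2$ with $A_n\ge0$, $A_\infty=\lim_nA_n$. The Bayesian strategy with prior density $\pi$ (a nonnegative integrable function on $[0,1]$ with positive integral, not necessarily $1$) bets $M_n=\epsilon_n\mathcal K_{n-1}$ where $$\epsilon_n=\frac{\int_0^1\epsilon\prod_{i=1}^{n-1}(1+\epsilon x_i)\pi(\epsilon)\,d\epsilon}{\int_0^1\prod_{i=1}^{n-1}(1+\epsilon x_i)\pi(\epsilon)\,d\epsilon},$$ with initial capital $\int_0^1\pi(\epsilon)d\epsilon$; its capital process is $\mathcal K_n^\pi=\int_0^1\prod_{i=1}^n(1+\epsilon x_i)\pi(\epsilon)\,d\epsilon$. *)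

theory Defs
  imports "HOL-Analysis.Analysis"
begin

section \<open>Iterated logarithms\<close>

text \<open>Isabelle's \<^const>\<open>ln\<close> is total, so this agrees with the mathematical \<open>ln\<^sub>b x\<close> only where
  \<open>ln\<^sub>k x > 0\<close> for all \<open>k < b\<close>.  If \<open>iter_ln b (1 / e) > 0\<close> holds for all \<open>0 < e \<le> \<epsilon>0\<close> (with \<open>b \<ge> 1\<close>),
  this is the case throughout: otherwise \<open>1 / \<epsilon>0 \<le> T\<close> for the point \<open>T = exp\<^sub>b\<^sub>-\<^sub>1 1\<close>, where
  \<open>iter_ln b T = 0\<close>.\<close>

definition iter_ln :: "nat \<Rightarrow> real \<Rightarrow> real" where
  "iter_ln b x = (ln ^^ b) x"

section \<open>The one-sided unbounded forecasting game\<close>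

text \<open>Indices are shifted by one: for a path \<open>x\<close>, Reality's move in round \<open>n \<ge> 1\<close> is \<open>x (n - 1)\<close>.
  Hence \<open>history x n\<close> is the list of the moves of rounds \<open>1, \<dots>, n\<close>.\<close>

definition paths :: "(nat \<Rightarrow> real) set" where
  "paths = {x. \<forall>i. x i \<ge> -1}"

definition history :: "(nat \<Rightarrow> real) \<Rightarrow> nat \<Rightarrow> real list" where
  "history x n = map x [0..<n]"

text \<open>A strategy maps the moves \<open>[x\<^sub>1, \<dots>, x\<^sub>n\<^sub>-\<^sub>1]\<close> made so far to the bet \<open>M\<^sub>n\<close>.\<close>

type_synonym strategy = "real list \<Rightarrow> real"

function capital :: "real \<Rightarrow> strategy \<Rightarrow> real list \<Rightarrow> real" where
  "capital K0 M h =
     (if h = [] then K0 else capital K0 M (butlast h) + M (butlast h) * last h)"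
  by auto
termination
  by (relation "Wellfounded.measure (\<lambda>(_, _, h). length h)") auto

declare capital.simps [simp del]

lemma capital_Nil [simp]: "capital K0 M [] = K0"
  by (simp add: capital.simps)

lemma capital_snoc [simp]: "capital K0 M (h @ [y]) = capital K0 M h + M h * y"
  by (simp add: capital.simps [of K0 M "h @ [y]"])

text \<open>Events are sets of paths.\<close>

definition weakly_forces :: "real \<Rightarrow> strategy \<Rightarrow> (nat \<Rightarrow> real) set \<Rightarrow> bool" where
  "weakly_forces K0 M E \<longleftrightarrow>
     K0 > 0 \<and>
     (\<forall>x\<in>paths. \<forall>n. capital K0 M (history x n) \<ge> 0) \<and>
     (\<forall>x\<in>paths - E. limsup (\<lambda>n. ereal (capital K0 M (history x n))) = \<infinity>)"

definition S_sum :: "(nat \<Rightarrow> real) \<Rightarrow> nat \<Rightarrow> real" where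
  "S_sum x n = (\<Sum>i<n. x i)"

definition A_norm :: "(nat \<Rightarrow> real) \<Rightarrow> nat \<Rightarrow> real" where
  "A_norm x n = sqrt (\<Sum>i<n. (x i)\<^sup>2)"

section \<open>Bayesian strategies\<close>

definition bayes_capital0 :: "(real \<Rightarrow> real) \<Rightarrow> real" where
  "bayes_capital0 p = (LINT e:{0..1}|lborel. p e)"

definition bayes_fraction :: "(real \<Rightarrow> real) \<Rightarrow> real list \<Rightarrow> real" where
  "bayes_fraction p h =
     (LINT e:{0..1}|lborel. e * (\<Prod>i<length h. 1 + e * h ! i) * p e) /
     (LINT e:{0..1}|lborel. (\<Prod>i<length h. 1 + e * h ! i) * p e)"

lemma capital_cong [fundef_cong]:
  assumes "K0 = K0'" "h = h'" "\<And>g. length g < length h' \<Longrightarrow> M g = M' g"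
  shows "capital K0 M h = capital K0' M' h'"
proof -
  have "(\<And>g. length g < length h' \<Longrightarrow> M g = M' g) \<Longrightarrow> capital K0 M h' = capital K0 M' h'"
    by (induction h' rule: rev_induct) auto
  with assms show ?thesis by simp
qed

text \<open>The bet \<open>M\<^sub>n = \<epsilon>\<^sub>n K\<^sub>n\<^sub>-\<^sub>1\<close>, where \<open>K\<^sub>n\<^sub>-\<^sub>1\<close> is the capital reached by this very strategy; the
  recursion terminates because that capital depends only on earlier bets.\<close>

function bayes_bet :: "(real \<Rightarrow> real) \<Rightarrow> strategy" where
  "bayes_bet p h = bayes_fraction p h * capital (bayes_capital0 p) (\<lambda>g. bayes_bet p g) h"
  by auto
termination
  by (relation "Wellfounded.measure (\<lambda>(_, h). length h)") auto

declare bayes_bet.simps [simp del]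

section \<open>The prior density and the boundary function\<close>

definition prior :: "nat \<Rightarrow> real \<Rightarrow> real \<Rightarrow> real \<Rightarrow> real" where
  "prior b \<gamma> \<epsilon>0 e =
     (if 0 < e \<and> e < \<epsilon>0
      then 1 / (e * (\<Prod>k=1..b - 1. iter_ln k (1 / e)) * iter_ln b (1 / e) powr (1 + \<gamma>))
      else 0)"

text \<open>Only the values for large \<open>l\<close> are meaningful.\<close>

definition psi :: "nat \<Rightarrow> real \<Rightarrow> real \<Rightarrow> real" where
  "psi b \<gamma> l =
     sqrt (2 * iter_ln 2 l + 3 * iter_ln 3 l + (\<Sum>k=4..b. 2 * iter_ln k l)
           + 2 * (1 + 2 * \<gamma>) * iter_ln (b + 1) l)"

end

theory Submission
  imports Defs "HOL-Real_Asymp.Real_Asymp"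
begin

text \<open>Since \<open>ln (1 + t) \<ge> t - t\<^sup>2 / 2\<close> for \<open>t \<ge> 0\<close> and negative moves are bounded by \<open>1\<close>, every fixed
  betting fraction \<open>\<epsilon> \<le> 1/2\<close> earns at least \<open>exp (\<epsilon> S\<^sub>n - \<epsilon>\<^sup>2 A\<^sub>n\<^sup>2 / 2 - \<epsilon>\<^sup>3 A\<^sub>n\<^sup>2)\<close>.  If \<open>S\<^sub>n > A\<^sub>n \<psi>\<close> with
  \<open>\<psi> = \<psi>(A\<^sub>n\<^sup>2)\<close>, then this is at least \<open>exp (\<psi>\<^sup>2 / 2 - 3/2)\<close> on the whole window
  \<open>\<psi> \<le> \<epsilon> A\<^sub>n \<le> \<psi> + 1\<close>.  The prior mass of that window is at least \<open>1 / ((\<psi> + 1) D)\<close>, where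
  \<open>D = ln A\<^sub>n\<^sup>2 \<cdots> ln\<^sub>b\<^sub>-\<^sub>1 A\<^sub>n\<^sup>2 (ln\<^sub>b A\<^sub>n\<^sup>2)\<^sup>1\<^sup>+\<^sup>\<gamma>\<close>.  The boundary is chosen such that
  \<open>exp (\<psi>\<^sup>2 / 2) = D (ln\<^sub>2 A\<^sub>n\<^sup>2)\<^sup>1\<^sup>/\<^sup>2 (ln\<^sub>b A\<^sub>n\<^sup>2)\<^sup>\<gamma>\<close>; as \<open>\<psi> + 1\<close> is of order \<open>(ln\<^sub>2 A\<^sub>n\<^sup>2)\<^sup>1\<^sup>/\<^sup>2\<close>, the capital
  exceeds a constant times \<open>(ln\<^sub>b A\<^sub>n\<^sup>2)\<^sup>\<gamma>\<close>, which is unbounded along the crossing times.\<close>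

subsection \<open>Iterated logarithms\<close>

lemma iter_ln_0 [simp]: "iter_ln 0 x = x"
  by (simp add: iter_ln_def)

lemma iter_ln_Suc: "iter_ln (Suc k) x = ln (iter_ln k x)"
  by (simp add: iter_ln_def)

lemma iter_ln_funpow_exp: "iter_ln k ((exp ^^ k) (y::real)) = y"
proof (induction k arbitrary: y)
  case (Suc k)
  have "(exp ^^ Suc k) y = (exp ^^ k) (exp y)"
    by (simp only: funpow_Suc_right o_apply)
  then show ?case by (simp add: iter_ln_Suc Suc.IH)
qed simp

lemma funpow_exp_nonneg: "(0::real) \<le> (exp ^^ k) 0"
  by (cases k) auto

text \<open>Each logarithm strips one \<open>exp\<close> from the threshold. The condition
  \<open>(exp ^^ b) 0 < x\<close> serves as the domain on which the iterates up to order
  \<open>b\<close> are positive, so that order \<open>Suc b\<close> is still the logarithm of a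
  positive number.\<close>

lemma iter_ln_gt:
  assumes "(exp ^^ b) (0::real) < x" "k \<le> b"
  shows "(exp ^^ (b - k)) 0 < iter_ln k x"
  using assms(2)
proof (induction k)
  case (Suc k)
  have eq: "b - k = Suc (b - Suc k)" using Suc.prems by simp
  have "exp ((exp ^^ (b - Suc k)) (0::real)) < iter_ln k x"
    using Suc unfolding eq by simp
  then have "(exp ^^ (b - Suc k)) 0 < ln (iter_ln k x)"
    by (smt (verit) exp_gt_zero exp_less_cancel_iff exp_ln)
  then show ?case by (simp add: iter_ln_Suc)
qed (use assms in simp)

lemma iter_ln_pos:
  assumes "(exp ^^ b) 0 < x" "k \<le> b"
  shows "0 < iter_ln k x"
  using iter_ln_gt[OF assms] funpow_exp_nonneg[of "b - k"] by linarith

lemma iter_ln_ge_Suc: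
  assumes "(exp ^^ b) 0 < x" "k \<le> b"
  shows "iter_ln (Suc k) x \<le> iter_ln k x"
  using iter_ln_pos[OF assms] ln_bound[of "iter_ln k x"] by (simp add: iter_ln_Suc)

lemma iter_ln_antimono:
  assumes "(exp ^^ b) 0 < x" "j \<le> k" "k \<le> Suc b"
  shows "iter_ln k x \<le> iter_ln j x"
  using assms(2,3)
proof (induction k rule: dec_induct)
  case (step k)
  then show ?case using iter_ln_ge_Suc[OF assms(1), of k] by linarith
qed simp

lemma iter_ln_mono:
  assumes "(exp ^^ b) 0 < x" "x \<le> y" "k \<le> Suc b"
  shows "iter_ln k x \<le> iter_ln k y"
  using assms(3)
proof (induction k)
  case (Suc k)
  then show ?case using iter_ln_pos[OF assms(1), of k] by (simp add: iter_ln_Suc)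
qed (use assms in simp)

lemma filterlim_iter_ln: "filterlim (iter_ln k) at_top at_top"
proof (induction k)
  case 0
  then show ?case by (simp add: iter_ln_def filterlim_ident id_def)
next
  case (Suc k)
  have "iter_ln (Suc k) = (\<lambda>x. ln (iter_ln k x))" by (auto simp: iter_ln_Suc)
  then show ?case using filterlim_compose[OF ln_at_top Suc.IH] by simp
qed

text \<open>The chain rule divides by one more iterate each time, starting with \<open>x\<close>
  itself for \<open>j = 0\<close>. This is the shape of the prior, whose antiderivative it
  yields.\<close>

lemma DERIV_iter_ln:
  assumes "(exp ^^ b) 0 < x" "k \<le> Suc b"
  shows "(iter_ln k has_real_derivative 1 / (\<Prod>j<k. iter_ln j x)) (at x)"
  using assms(2)
proof (induction k)
  case 0
  then show ?case by (simp add: iter_ln_def id_def)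
next
  case (Suc k)
  have eq: "iter_ln (Suc k) = (\<lambda>x. ln (iter_ln k x))" by (auto simp: iter_ln_Suc)
  have "0 < iter_ln k x" using iter_ln_pos[OF assms(1)] Suc.prems by simp
  with Suc show ?case unfolding eq
    by (auto intro!: derivative_eq_intros simp: field_simps)
qed

subsection \<open>The capital process of a Bayesian strategy\<close>

text \<open>The closed form of the capital process; \<open>capital_bayes_bet\<close> identifies it
  with the recursively defined capital.\<close>

definition bayes_mixture :: "(real \<Rightarrow> real) \<Rightarrow> real list \<Rightarrow> real" where
  "bayes_mixture p h = (LINT e:{0..1}|lborel. (\<Prod>i<length h. 1 + e * h ! i) * p e)"

lemma set_integrable_prod_mult:
  fixes p :: "real \<Rightarrow> real" and g :: "real \<Rightarrow> real"
  assumes "set_integrable lborel {0..1} p" "continuous_on UNIV g"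
  shows "set_integrable lborel {0..1} (\<lambda>e. g e * p e)"
proof -
  have "compact (g ` {0..1})"
    using assms(2) by (intro compact_continuous_image) (auto intro: continuous_on_subset)
  then obtain B where B: "\<And>e. e \<in> {0..1} \<Longrightarrow> norm (g e) \<le> B"
    by (metis compact_imp_bounded bounded_iff imageI)
  have m: "g \<in> borel_measurable borel"
    using assms(2) by (rule borel_measurable_continuous_onI)
  have i: "integrable lborel (\<lambda>e. indicator {0..1} e *\<^sub>R p e)"
    using assms(1) unfolding set_integrable_def .
  have "integrable lborel (\<lambda>e. g e * (indicator {0..1} e *\<^sub>R p e))"
  proof (rule Bochner_Integration.integrable_bound)
    show "integrable lborel (\<lambda>e. B * (indicator {0..1} e *\<^sub>R p e))" using i by simp
    show "(\<lambda>e. g e * (indicator {0..1} e *\<^sub>R p e)) \<in> borel_measurable lborel"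
      using m borel_measurable_integrable[OF i] by (intro borel_measurable_times) auto
    show "AE e in lborel. norm (g e * (indicator {0..1} e *\<^sub>R p e))
            \<le> norm (B * (indicator {0..1} e *\<^sub>R p e))"
    proof (rule AE_I2)
      fix e :: real
      have "norm (g e) \<le> norm B" if "e \<in> {0..1}" using B[OF that] by simp
      then show "norm (g e * (indicator {0..1} e *\<^sub>R p e)) \<le> norm (B * (indicator {0..1} e *\<^sub>R p e))"
        by (cases "e \<in> {0..1}") (simp_all add: abs_mult mult_right_mono)
    qed
  qed
  then show ?thesis unfolding set_integrable_def by (simp add: ac_simps)
qed

lemma bayes_mixture_integrable:
  fixes p :: "real \<Rightarrow> real"
  assumes "set_integrable lborel {0..1} p"
  shows "set_integrable lborel {0..1} (\<lambda>e. (\<Prod>i<length h. 1 + e * h ! i) * p e)"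
  by (rule set_integrable_prod_mult[OF assms]) (intro continuous_intros)

text \<open>Expanding the last factor \<open>1 + e * y\<close> splits off \<open>y\<close> times the
  numerator of \<open>bayes_fraction\<close>.\<close>

lemma bayes_mixture_snoc:
  assumes "set_integrable lborel {0..1} p"
  shows "bayes_mixture p (h @ [y]) =
    bayes_mixture p h + (LINT e:{0..1}|lborel. e * (\<Prod>i<length h. 1 + e * h ! i) * p e) * y"
proof -
  let ?P = "\<lambda>e. (\<Prod>i<length h. 1 + e * h ! i)"
  have "set_integrable lborel {0..1} (\<lambda>e. (e * ?P e) * p e)"
    by (rule set_integrable_prod_mult[OF assms]) (intro continuous_intros)
  then have i: "set_integrable lborel {0..1} (\<lambda>e. (e * ?P e * p e) * y)"
    by simp
  have "(\<Prod>i<length (h @ [y]). 1 + e * (h @ [y]) ! i) * p e = ?P e * p e + (e * ?P e * p e) * y" for e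
    by (simp add: nth_append algebra_simps)
  then show ?thesis
    unfolding bayes_mixture_def
    by (simp only: set_integral_add[OF bayes_mixture_integrable[OF assms] i] set_integral_mult_left)
qed

text \<open>By induction the capital is the denominator of \<open>bayes_fraction\<close>; as it is
  positive, it cancels, the bet becomes the numerator, and \<open>bayes_mixture_snoc\<close> is the
  capital recursion.\<close>

lemma capital_bayes_bet:
  assumes "set_integrable lborel {0..1} p"
    and pos: "\<And>g. set g \<subseteq> {-1..} \<Longrightarrow> 0 < bayes_mixture p g"
    and "set h \<subseteq> {-1..}"
  shows "capital (bayes_capital0 p) (bayes_bet p) h = bayes_mixture p h"
  using assms(3)
proof (induction h rule: rev_induct)
  case Nil
  then show ?case by (simp add: bayes_mixture_def bayes_capital0_def)
next
  case (snoc y h)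
  then have IH: "capital (bayes_capital0 p) (bayes_bet p) h = bayes_mixture p h" by simp
  have "bayes_mixture p h > 0" using snoc.prems pos by simp
  then have "bayes_bet p h = (LINT e:{0..1}|lborel. e * (\<Prod>i<length h. 1 + e * h ! i) * p e)"
    using bayes_bet.simps[of p h] IH
    by (simp add: bayes_fraction_def bayes_mixture_def)
  then show ?case by (simp add: IH bayes_mixture_snoc[OF assms(1)])
qed

lemma bayes_mixture_ge:
  assumes int: "set_integrable lborel {0..1} p"
    and nn: "\<And>e. 0 \<le> e \<Longrightarrow> e \<le> 1 \<Longrightarrow> 0 \<le> p e"
    and h: "set h \<subseteq> {-1..}"
    and ab: "0 \<le> l" "l \<le> r" "r \<le> 1"
    and c: "\<And>e. l \<le> e \<Longrightarrow> e \<le> r \<Longrightarrow> c \<le> (\<Prod>i<length h. 1 + e * h ! i) * p e"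
  shows "c * (r - l) \<le> bayes_mixture p h"
proof -
  have P: "0 \<le> (\<Prod>i<length h. 1 + e * h ! i)" if "0 \<le> e" "e \<le> 1" for e
  proof (rule prod_nonneg)
    fix i assume "i \<in> {..<length h}"
    then have "-1 \<le> h ! i" using h nth_mem by fastforce
    then have "e * -1 \<le> e * h ! i" using that by (intro mult_left_mono) auto
    then show "0 \<le> 1 + e * h ! i" using that by simp
  qed
  have "c * (r - l) = (LINT e|lborel. indicator {l..r} e *\<^sub>R c)"
    using ab by simp
  also have "\<dots> \<le> bayes_mixture p h"
    unfolding bayes_mixture_def set_lebesgue_integral_def
  proof (rule integral_mono)
    show "integrable lborel (\<lambda>e. indicator {l..r} e *\<^sub>R c)"
      using ab by (intro integrable_scaleR_left integrable_real_indicator) auto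
    show "integrable lborel (\<lambda>e. indicator {0..1} e *\<^sub>R ((\<Prod>i<length h. 1 + e * h ! i) * p e))"
      using bayes_mixture_integrable[OF int] unfolding set_integrable_def .
    show "indicator {l..r} e *\<^sub>R c \<le> indicator {0..1} e *\<^sub>R ((\<Prod>i<length h. 1 + e * h ! i) * p e)"
      for e using c[of e] ab P[of e] nn[of e] by (auto simp: indicator_def)
  qed
  finally show ?thesis .
qed

subsection \<open>Lower bound for a single betting fraction\<close>

text \<open>For \<open>t \<ge> 0\<close> the quadratic Taylor polynomial is a lower bound however
  large \<open>t\<close> is, which copes with unbounded positive moves. The cubic term corrects
  negative \<open>t\<close> only.\<close>

lemma ln_one_plus_ge:
  fixes t :: real
  assumes "-1/2 \<le> t"
  shows "t - t\<^sup>2 / 2 - max 0 (- t) ^ 3 \<le> ln (1 + t)"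
proof (cases "0 \<le> t")
  case True
  have "(\<lambda>t. ln (1 + t) - t + t\<^sup>2 / 2) 0 \<le> (\<lambda>t. ln (1 + t) - t + t\<^sup>2 / 2) t"
  proof (rule DERIV_nonneg_imp_nondecreasing[OF True])
    fix x :: real assume x: "0 \<le> x" "x \<le> t"
    have "((\<lambda>t. ln (1 + t) - t + t\<^sup>2 / 2) has_real_derivative x\<^sup>2 / (1 + x)) (at x)"
      using x by (auto intro!: derivative_eq_intros simp: field_simps power2_eq_square)
    then show "\<exists>y. ((\<lambda>t. ln (1 + t) - t + t\<^sup>2 / 2) has_real_derivative y) (at x) \<and> 0 \<le> y"
      using x by (intro exI[of _ "x\<^sup>2 / (1 + x)"]) auto
  qed
  then show ?thesis using True by simp
next
  case False
  let ?g = "\<lambda>t. ln (1 + t) - t + t\<^sup>2 / 2 - t ^ 3 :: real"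
  have "?g t \<ge> ?g 0"
  proof (rule DERIV_nonpos_imp_nonincreasing[of t 0 ?g])
    show "t \<le> 0" using False by simp
    fix x :: real assume x: "t \<le> x" "x \<le> 0"
    then have x1: "1/2 \<le> 1 + x" using assms by simp
    have "(?g has_real_derivative (x\<^sup>2 * (-2 - 3 * x) / (1 + x))) (at x)"
      using x1 by (auto intro!: derivative_eq_intros simp: field_simps power2_eq_square)
    \<comment> \<open>The sign holds for \<open>x \<ge> -2/3\<close>, hence on the range
      \<open>x \<ge> -1/2\<close>.\<close>
    moreover have "x\<^sup>2 * (-2 - 3 * x) / (1 + x) \<le> 0"
      using x x1 by (intro divide_nonpos_pos mult_nonneg_nonpos) auto
    ultimately show "\<exists>y. (?g has_real_derivative y) (at x) \<and> y \<le> 0" by blast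
  qed
  then show ?thesis using False by (simp add: max_def)
qed

lemma prod_one_plus_ge:
  assumes x: "x \<in> paths" and e: "0 \<le> e" "e \<le> 1/2"
  shows "exp (e * S_sum x n - e\<^sup>2 * (A_norm x n)\<^sup>2 / 2 - e ^ 3 * (A_norm x n)\<^sup>2)
          \<le> (\<Prod>i<n. 1 + e * x i)"
proof -
  have *: "exp (e * x i - e\<^sup>2 * (x i)\<^sup>2 / 2 - e ^ 3 * (x i)\<^sup>2) \<le> 1 + e * x i" for i
  proof -
    have xi: "-1 \<le> x i" using x by (simp add: paths_def)
    have "e * -1 \<le> e * x i" using xi e by (intro mult_left_mono) auto
    then have t: "-1/2 \<le> e * x i" using e by simp
    \<comment> \<open>Positive moves cause no cubic error; a negative move has modulus at most 1, so
      its cube is dominated by its square.\<close>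
    have "max 0 (- x i) ^ 3 \<le> (x i)\<^sup>2"
    proof (cases "0 \<le> x i")
      case False
      then have "(x i)\<^sup>2 * (- x i) \<le> (x i)\<^sup>2 * 1" using xi by (intro mult_left_mono) auto
      then show ?thesis using False by (simp add: max_def power3_eq_cube power2_eq_square)
    qed simp
    then have "e ^ 3 * max 0 (- x i) ^ 3 \<le> e ^ 3 * (x i)\<^sup>2" using e by (intro mult_left_mono) auto
    moreover have "max 0 (- (e * x i)) = e * max 0 (- x i)"
      using e by (auto simp: max_def mult_le_0_iff zero_le_mult_iff)
    ultimately have "max 0 (- (e * x i)) ^ 3 \<le> e ^ 3 * (x i)\<^sup>2"
      by (simp add: power_mult_distrib)
    then have "e * x i - e\<^sup>2 * (x i)\<^sup>2 / 2 - e ^ 3 * (x i)\<^sup>2 \<le> ln (1 + e * x i)"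
      using ln_one_plus_ge[OF t] by (simp add: power_mult_distrib)
    then have "exp (e * x i - e\<^sup>2 * (x i)\<^sup>2 / 2 - e ^ 3 * (x i)\<^sup>2) \<le> exp (ln (1 + e * x i))" by simp
    also have "\<dots> = 1 + e * x i" using t by (intro exp_ln) linarith
    finally show ?thesis .
  qed
  have A: "(A_norm x n)\<^sup>2 = (\<Sum>i<n. (x i)\<^sup>2)"
    by (simp add: A_norm_def sum_nonneg)
  have "exp (e * S_sum x n - e\<^sup>2 * (A_norm x n)\<^sup>2 / 2 - e ^ 3 * (A_norm x n)\<^sup>2)
      = exp (\<Sum>i<n. e * x i - e\<^sup>2 * (x i)\<^sup>2 / 2 - e ^ 3 * (x i)\<^sup>2)"
    unfolding A S_sum_def by (simp add: sum_subtractf sum_distrib_left sum_divide_distrib)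
  also have "\<dots> = (\<Prod>i<n. exp (e * x i - e\<^sup>2 * (x i)\<^sup>2 / 2 - e ^ 3 * (x i)\<^sup>2))"
    by (simp add: exp_sum)
  also have "\<dots> \<le> (\<Prod>i<n. 1 + e * x i)" using * by (intro prod_mono) auto
  finally show ?thesis .
qed

subsection \<open>The prior density\<close>

text \<open>Otherwise the reciprocal of the threshold \<open>(exp ^^ b) 0\<close> would be an
  admissible \<open>e\<close>, although \<open>iter_ln b\<close> vanishes at the threshold.\<close>

lemma funpow_exp_less_of_iter_ln_pos:
  assumes "0 < \<epsilon>0" "b \<ge> 1" "\<forall>e. 0 < e \<and> e \<le> \<epsilon>0 \<longrightarrow> iter_ln b (1 / e) > 0"
  shows "(exp ^^ b) 0 < 1 / \<epsilon>0"
proof (rule ccontr)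
  assume "\<not> (exp ^^ b) 0 < 1 / \<epsilon>0"
  then have le: "1 / \<epsilon>0 \<le> (exp ^^ b) 0" by simp
  then have pos: "0 < (exp ^^ b) (0::real)"
    using assms(1) less_le_trans[of 0 "1 / \<epsilon>0"] by simp
  have "1 / (exp ^^ b) 0 \<le> \<epsilon>0"
    using le pos assms(1) by (simp add: field_simps)
  with pos have "0 < 1 / (exp ^^ b) (0::real)" "1 / (exp ^^ b) 0 \<le> \<epsilon>0" by simp_all
  then have "iter_ln b ((exp ^^ b) 0) > 0" using assms(3)[rule_format, of "1 / (exp ^^ b) 0"] by simp
  then show False by (simp add: iter_ln_funpow_exp)
qed


text \<open>The denominator of the prior without its factor \<open>e\<close>, as a function of
  \<open>y = 1 / e\<close>.\<close>

definition log_prod :: "nat \<Rightarrow> real \<Rightarrow> real \<Rightarrow> real" where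
  "log_prod b \<gamma> y = (\<Prod>k=1..b - 1. iter_ln k y) * iter_ln b y powr (1 + \<gamma>)"

lemma prior_eq:
  "prior b \<gamma> \<epsilon>0 e = (if 0 < e \<and> e < \<epsilon>0 then 1 / (e * log_prod b \<gamma> (1 / e)) else 0)"
  by (simp add: prior_def log_prod_def mult.assoc)

lemma log_prod_pos:
  assumes "(exp ^^ b) 0 < y"
  shows "0 < log_prod b \<gamma> y"
proof -
  have "0 < (\<Prod>k=1..b - 1. iter_ln k y)"
    using iter_ln_pos[OF assms] by (intro prod_pos) auto
  then show ?thesis
    using iter_ln_pos[OF assms, of b] by (simp add: log_prod_def)
qed

lemma log_prod_mono:
  assumes "(exp ^^ b) 0 < x" "x \<le> y" "-1 \<le> \<gamma>"
  shows "log_prod b \<gamma> x \<le> log_prod b \<gamma> y"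
proof -
  have pos: "0 < iter_ln k x" if "k \<le> b" for k using iter_ln_pos[OF assms(1) that] .
  have mono: "iter_ln k x \<le> iter_ln k y" if "k \<le> b" for k
    using iter_ln_mono[OF assms(1,2)] that by simp
  have "(\<Prod>k=1..b - 1. iter_ln k x) \<le> (\<Prod>k=1..b - 1. iter_ln k y)"
    by (intro prod_mono conjI less_imp_le[OF pos] mono) auto
  moreover have "iter_ln b x powr (1 + \<gamma>) \<le> iter_ln b y powr (1 + \<gamma>)"
    using assms(3) pos[of b] mono[of b] by (intro powr_mono2) auto
  moreover have "0 \<le> (\<Prod>k=1..b - 1. iter_ln k x)"
    by (intro prod_nonneg less_imp_le[OF pos]) auto
  ultimately show ?thesis unfolding log_prod_def by (intro mult_mono) auto
qed

context
  fixes b :: nat and \<gamma> \<epsilon>0 :: real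
  assumes b: "b \<ge> 1" and \<gamma>: "\<gamma> > 0" and \<epsilon>0: "0 < \<epsilon>0" "\<epsilon>0 < 1"
    and T: "(exp ^^ b) 0 < 1 / \<epsilon>0"
begin

lemma inverse_gt:
  assumes "0 < e" "e \<le> \<epsilon>0"
  shows "(exp ^^ b) 0 < 1 / e"
proof -
  have "1 / \<epsilon>0 \<le> 1 / e" using assms by (simp add: frac_le)
  then show ?thesis using T by linarith
qed

lemma prior_nonneg: "0 \<le> prior b \<gamma> \<epsilon>0 e"
  using log_prod_pos[OF inverse_gt, of e \<gamma>] by (auto simp: prior_eq)

text \<open>Both factors of the denominator grow when \<open>e\<close> becomes \<open>r\<close> and
  \<open>1 / e\<close> becomes \<open>y\<close>; the result is a bound uniform over a window of
  fractions.\<close>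

lemma prior_ge:
  assumes "0 < e" "e < \<epsilon>0" "e \<le> r" "1 / e \<le> y"
  shows "1 / (r * log_prod b \<gamma> y) \<le> prior b \<gamma> \<epsilon>0 e"
proof -
  have gt: "(exp ^^ b) 0 < 1 / e" using inverse_gt assms by simp
  have "e * log_prod b \<gamma> (1 / e) \<le> r * log_prod b \<gamma> y"
    using assms log_prod_pos[OF gt, of \<gamma>] log_prod_mono[OF gt assms(4), of \<gamma>] \<gamma>
    by (intro mult_mono) auto
  then show ?thesis
    using assms log_prod_pos[OF gt, of \<gamma>] by (auto simp: prior_eq intro!: frac_le)
qed

lemma prior_integrable: "set_integrable lborel {0..1} (prior b \<gamma> \<epsilon>0)"
proof -
  define f where "f = (\<lambda>e. 1 / (e * log_prod b \<gamma> (1 / e)))"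
  \<comment> \<open>An antiderivative of the prior: in the chain rule the factor
    \<open>j = 0\<close>, which is \<open>1 / e\<close>, turns \<open>1 / e\<^sup>2\<close> into
    \<open>1 / e\<close>. As \<gamma> > 0, it tends to 0 at the singularity \<open>e = 0\<close>,
    which gives integrability.\<close>
  define F where "F = (\<lambda>e. (1 / \<gamma>) * iter_ln b (1 / e) powr (- \<gamma>))"
  have D: "(F has_real_derivative f e) (at e)" if e: "0 < e" "e \<le> \<epsilon>0" for e
  proof -
    have gt: "(exp ^^ b) 0 < 1 / e" using inverse_gt e by simp
    have pos: "0 < iter_ln k (1 / e)" if "k \<le> b" for k using iter_ln_pos[OF gt that] .
    let ?P = "\<Prod>j<b. iter_ln j (1 / e)" and ?L = "iter_ln b (1 / e)"
    have set: "{..<b} = insert 0 {1..b - 1}" using b by auto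
    have P: "?P = (1 / e) * (\<Prod>k=1..b - 1. iter_ln k (1 / e))" unfolding set by simp
    have Ppos: "0 < (\<Prod>k=1..b - 1. iter_ln k (1 / e))" by (intro prod_pos) (auto intro: pos)
    have DL: "((\<lambda>e. iter_ln b (1 / e)) has_real_derivative (1 / ?P) * (- 1 / e\<^sup>2)) (at e)"
    proof (rule DERIV_chain2[of "iter_ln b" _ "\<lambda>e. 1 / e"])
      show "(iter_ln b has_real_derivative 1 / ?P) (at (1 / e))"
        using DERIV_iter_ln[OF gt, of b] by simp
      show "((\<lambda>e. 1 / e) has_real_derivative - 1 / e\<^sup>2) (at e)"
        using e by (auto intro!: derivative_eq_intros simp: power2_eq_square)
    qed
    have "(F has_real_derivative
        (1 / \<gamma>) * (- \<gamma> * ?L powr (- \<gamma> - 1) * ((1 / ?P) * (- 1 / e\<^sup>2)))) (at e)"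
      unfolding F_def using DERIV_cmult[OF DERIV_fun_powr[OF DL pos[OF order_refl], of "- \<gamma>"], of "1 / \<gamma>"] by simp
    moreover have "- \<gamma> - 1 = - (1 + \<gamma>)" by simp
    then have "?L powr (- \<gamma> - 1) = 1 / ?L powr (1 + \<gamma>)"
      by (simp only: powr_minus_divide)
    ultimately show ?thesis
      using \<gamma> e Ppos by (simp add: f_def log_prod_def P power2_eq_square ac_simps)
  qed
  have cont: "isCont f e" if e: "0 < e" "e \<le> \<epsilon>0" for e
  proof -
    have gt: "(exp ^^ b) 0 < 1 / e" using inverse_gt e by simp
    have c: "isCont (\<lambda>e. iter_ln k (1 / e)) e" if "k \<le> b" for k
    proof (rule isCont_o2[of _ "\<lambda>e. 1 / e"])
      show "isCont (\<lambda>e. 1 / e) e" using e by (intro continuous_intros) auto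
      show "isCont (iter_ln k) (1 / e)" using DERIV_isCont[OF DERIV_iter_ln[OF gt, of k]] that by simp
    qed
    have "isCont (\<lambda>e. log_prod b \<gamma> (1 / e)) e"
      unfolding log_prod_def using iter_ln_pos[OF gt, of b]
      by (intro continuous_intros c) auto
    then show ?thesis
      unfolding f_def using e log_prod_pos[OF gt, of \<gamma>] by (intro continuous_intros) auto
  qed
  have "set_integrable lborel (einterval (ereal 0) (ereal \<epsilon>0)) f"
  proof (rule interval_integral_FTC_nonneg(1))
    show "ereal 0 < ereal \<epsilon>0" using \<epsilon>0 by simp
    show "(F has_real_derivative f e) (at e)" "isCont f e" if "ereal 0 < ereal e" "ereal e < ereal \<epsilon>0" for e
      using D[of e] cont[of e] that by auto
    show "AE e in lborel. ereal 0 < ereal e \<longrightarrow> ereal e < ereal \<epsilon>0 \<longrightarrow> 0 \<le> f e"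
      using log_prod_pos[OF inverse_gt, of _ \<gamma>] by (auto simp: f_def less_imp_le)
    have "filterlim (\<lambda>e::real. 1 / e) at_top (at_right 0)"
      using filterlim_inverse_at_top_right by (simp add: inverse_eq_divide)
    then have "((\<lambda>e. iter_ln b (1 / e) powr (- \<gamma>)) \<longlongrightarrow> 0) (at_right 0)"
      using filterlim_compose[OF filterlim_iter_ln[of b]] \<gamma> by (intro tendsto_neg_powr) auto
    then have "(F \<longlongrightarrow> 0) (at_right 0)"
      unfolding F_def using tendsto_mult_right_zero by blast
    then show "((F \<circ> real_of_ereal) \<longlongrightarrow> 0) (at_right (ereal 0))"
      by (simp only: ereal_tendsto_simps1)
    have "(F \<longlongrightarrow> F \<epsilon>0) (at \<epsilon>0)"
      using DERIV_isCont[OF D[of \<epsilon>0]] \<epsilon>0 by (simp add: isCont_def)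
    then have "(F \<longlongrightarrow> F \<epsilon>0) (at_left \<epsilon>0)"
      by (rule tendsto_within_subset) auto
    then show "((F \<circ> real_of_ereal) \<longlongrightarrow> F \<epsilon>0) (at_left (ereal \<epsilon>0))"
      by (simp only: ereal_tendsto_simps1)
  qed
  moreover have "indicator (einterval (ereal 0) (ereal \<epsilon>0)) e *\<^sub>R f e
      = indicator {0..1} e *\<^sub>R prior b \<gamma> \<epsilon>0 e" for e
    using \<epsilon>0 by (auto simp: indicator_def f_def prior_eq)
  ultimately show ?thesis unfolding set_integrable_def by simp
qed

text \<open>On a window strictly inside the support the prior is bounded below, and every factor of
  the product is at least \<open>1 - r > 0\<close>.\<close>

lemma bayes_mixture_prior_pos:
  assumes h: "set h \<subseteq> {-1..}"
  shows "0 < bayes_mixture (prior b \<gamma> \<epsilon>0) h"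
proof -
  define l r where "l = \<epsilon>0 / 4" and "r = \<epsilon>0 / 2"
  have lr: "0 < l" "l < r" "r < \<epsilon>0" "r < 1" using \<epsilon>0 by (auto simp: l_def r_def)
  have gt: "(exp ^^ b) 0 < 1 / l" using inverse_gt lr by simp
  define c where "c = (1 - r) ^ length h * (1 / (r * log_prod b \<gamma> (1 / l)))"
  have c: "0 < c" using lr log_prod_pos[OF gt, of \<gamma>] by (simp add: c_def)
  have "c * (r - l) \<le> bayes_mixture (prior b \<gamma> \<epsilon>0) h"
  proof (rule bayes_mixture_ge[OF prior_integrable prior_nonneg h])
    fix e assume e: "l \<le> e" "e \<le> r"
    have "(\<Prod>i<length h. 1 - r) \<le> (\<Prod>i<length h. 1 + e * h ! i)"
    proof (intro prod_mono conjI)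
      fix i assume "i \<in> {..<length h}"
      then have "-1 \<le> h ! i" using h nth_mem by fastforce
      then have "e * -1 \<le> e * h ! i" using e lr by (intro mult_left_mono) auto
      then show "1 - r \<le> 1 + e * h ! i" using e by simp
    qed (use lr in auto)
    moreover have "1 / (r * log_prod b \<gamma> (1 / l)) \<le> prior b \<gamma> \<epsilon>0 e"
      using e lr by (intro prior_ge) (auto simp: frac_le)
    ultimately show "c \<le> (\<Prod>i<length h. 1 + e * h ! i) * prior b \<gamma> \<epsilon>0 e"
      unfolding c_def using lr log_prod_pos[OF gt, of \<gamma>]
      by (intro mult_mono) (auto intro: order_trans[of 0 "(1 - r) ^ length h"])
  qed (use lr in auto)
  moreover have "0 < c * (r - l)" using c lr by simp
  ultimately show ?thesis by linarith
qed

text \<open>The bound \<open>(\<psi> + 1) ^ 3 \<le> A\<close> caps the cubic error at 1; the bounds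
  by \<open>\<epsilon>0\<close> and \<open>1 / 2\<close> keep the window in the support and in the
  range of \<open>prod_one_plus_ge\<close>. The window width \<open>1 / A\<close> cancels the
  \<open>A\<close> in \<open>1 / ?r\<close>.\<close>

lemma bayes_mixture_history_ge:
  assumes x: "x \<in> paths"
    and A: "A = A_norm x n" "1 \<le> A"
    and S: "A * \<psi> \<le> S_sum x n"
    and \<psi>: "1 \<le> \<psi>" "(\<psi> + 1) ^ 3 \<le> A" "(\<psi> + 1) / A < \<epsilon>0" "(\<psi> + 1) / A \<le> 1 / 2"
    and y: "(exp ^^ b) 0 < A\<^sup>2"
  shows "exp (\<psi>\<^sup>2 / 2 - 3 / 2) / ((\<psi> + 1) * log_prod b \<gamma> (A\<^sup>2))
    \<le> bayes_mixture (prior b \<gamma> \<epsilon>0) (history x n)"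
proof -
  let ?D = "log_prod b \<gamma> (A\<^sup>2)" and ?l = "\<psi> / A" and ?r = "(\<psi> + 1) / A"
  have Dpos: "0 < ?D" using log_prod_pos[OF y] .
  have len: "?r - ?l = 1 / A" using A by (simp add: field_simps)
  define c where "c = exp (\<psi>\<^sup>2 / 2 - 3 / 2) * (1 / (?r * ?D))"
  have "c * (?r - ?l) \<le> bayes_mixture (prior b \<gamma> \<epsilon>0) (history x n)"
  proof (rule bayes_mixture_ge[OF prior_integrable prior_nonneg])
    show "set (history x n) \<subseteq> {-1..}" using x by (auto simp: history_def paths_def)
    fix e assume e: "?l \<le> e" "e \<le> ?r"
    define u where "u = e * A"
    have e_eq: "e = u / A" using A by (simp add: u_def)
    have u: "\<psi> \<le> u" "u \<le> \<psi> + 1" using e A by (auto simp: u_def field_simps)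
    have e0: "0 < e" using u A \<psi> by (simp add: e_eq)
    have "u * \<psi> = e * (A * \<psi>)" by (simp add: u_def)
    also have "\<dots> \<le> e * S_sum x n" using S e0 by (intro mult_left_mono) auto
    finally have 1: "u * \<psi> \<le> e * S_sum x n" .
    have 2: "e\<^sup>2 * A\<^sup>2 = u\<^sup>2" by (simp add: u_def power_mult_distrib)
    have "u ^ 3 \<le> (\<psi> + 1) ^ 3" using u \<psi> by (intro power_mono) auto
    then have "u ^ 3 / A \<le> 1" using \<psi> A by simp
    then have 3: "e ^ 3 * A\<^sup>2 \<le> 1"
      using A by (simp add: e_eq power_divide power2_eq_square power3_eq_cube)
    \<comment> \<open>Since \<open>u * \<psi> - u\<^sup>2 / 2 = \<psi>\<^sup>2 / 2 - (u -
      \<psi>)\<^sup>2 / 2\<close>, missing the optimal fraction costs at most 1/2; with the cubic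
      error this makes 3/2.\<close>
    have "(u - \<psi>) * (u - \<psi>) \<le> 1 * 1" using u by (intro mult_mono) auto
    then have "\<psi>\<^sup>2 / 2 - 1 / 2 \<le> u * \<psi> - u\<^sup>2 / 2"
      by (simp add: power2_eq_square algebra_simps)
    with 1 2 3 have "\<psi>\<^sup>2 / 2 - 3 / 2 \<le> e * S_sum x n - e\<^sup>2 * A\<^sup>2 / 2 - e ^ 3 * A\<^sup>2" by linarith
    then have "exp (\<psi>\<^sup>2 / 2 - 3 / 2) \<le> exp (e * S_sum x n - e\<^sup>2 * A\<^sup>2 / 2 - e ^ 3 * A\<^sup>2)" by simp
    also have "\<dots> \<le> (\<Prod>i<n. 1 + e * x i)"
      unfolding A(1) using e0 order_trans[OF e(2) \<psi>(4)] by (intro prod_one_plus_ge[OF x]) auto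
    also have "\<dots> = (\<Prod>i<length (history x n). 1 + e * history x n ! i)"
      by (simp add: history_def)
    finally have 4: "exp (\<psi>\<^sup>2 / 2 - 3 / 2) \<le> (\<Prod>i<length (history x n). 1 + e * history x n ! i)" .
    \<comment> \<open>The bound \<open>1 / e \<le> A\<^sup>2\<close> is crude, but
      \<open>prior_ge\<close> uses it only inside logarithms, and it matches the argument of
      \<open>psi\<close>.\<close>
    have "A * 1 \<le> A * (A * u)" using A u \<psi> mult_mono[of 1 A 1 u] by (intro mult_left_mono) auto
    then have "1 / e \<le> A\<^sup>2"
      using A u \<psi> by (simp add: e_eq field_simps power2_eq_square)
    then have 5: "1 / (?r * ?D) \<le> prior b \<gamma> \<epsilon>0 e"
      using e e0 \<psi> by (intro prior_ge) auto
    show "c \<le> (\<Prod>i<length (history x n). 1 + e * history x n ! i) * prior b \<gamma> \<epsilon>0 e"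
      unfolding c_def using 4 5 A \<psi> Dpos
      by (intro mult_mono) (auto intro: order_trans[OF less_imp_le[OF exp_gt_zero] 4])
  qed (use A \<psi> \<epsilon>0 in \<open>auto simp: divide_right_mono\<close>)
  moreover have "c * (?r - ?l) = exp (\<psi>\<^sup>2 / 2 - 3 / 2) / ((\<psi> + 1) * ?D)"
    unfolding len c_def using A by simp
  ultimately show ?thesis by simp
qed

end

subsection \<open>The boundary function\<close>

text \<open>Every factor of \<open>log_prod\<close> is the exponential of a multiple of the next
  iterate, which explains the coefficients of \<open>psi\<close>. Half of the 3 is 1 from
  \<open>log_prod\<close> plus 1/2 from the square root; \<open>1 + 2 * \<gamma>\<close> is
  \<open>1 + \<gamma>\<close> from the prior plus a surplus \<open>\<gamma>\<close>.\<close>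

lemma psi_bounds:
  assumes b: "b \<ge> 4" and \<gamma>: "\<gamma> > 0" and y: "(exp ^^ Suc b) 0 < y"
  shows "2 * iter_ln 2 y \<le> (psi b \<gamma> y)\<^sup>2"
    and "(psi b \<gamma> y)\<^sup>2 \<le> (7 + 2 * real b + 4 * \<gamma>) * iter_ln 2 y"
    and "exp ((psi b \<gamma> y)\<^sup>2 / 2) = sqrt (iter_ln 2 y) * iter_ln b y powr \<gamma> * log_prod b \<gamma> y"
proof -
  let ?s = "\<Sum>k=4..b. iter_ln k y"
  have pos: "0 < iter_ln k y" if "k \<le> Suc b" for k using iter_ln_pos[OF y that] .
  have le: "iter_ln k y \<le> iter_ln 2 y" if "2 \<le> k" "k \<le> Suc b" for k
    using iter_ln_antimono[OF y that(1)] that by simp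
  have s0: "0 \<le> ?s" by (intro sum_nonneg less_imp_le[OF pos]) auto
  have p: "0 < iter_ln 2 y" "0 < iter_ln 3 y" "0 < iter_ln (b + 1) y"
    using b by (auto intro!: pos)
  have sq: "(psi b \<gamma> y)\<^sup>2
      = 2 * iter_ln 2 y + 3 * iter_ln 3 y + 2 * ?s + 2 * (1 + 2 * \<gamma>) * iter_ln (b + 1) y"
    unfolding psi_def using p s0 \<gamma> by (simp add: sum_distrib_left[symmetric])
  show "2 * iter_ln 2 y \<le> (psi b \<gamma> y)\<^sup>2"
    unfolding sq using p s0 \<gamma> by simp
  \<comment> \<open>The constant arises by bounding every iterate by \<open>iter_ln 2 y\<close>: the
    sum gives at most \<open>2 * b\<close>, and the rest
    \<open>2 + 3 + 2 * (1 + 2 * \<gamma>)\<close>.\<close>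
  have "?s \<le> (\<Sum>k=4..b. iter_ln 2 y)" by (intro sum_mono le) auto
  also have "\<dots> = real (card {4..b}) * iter_ln 2 y" by simp
  also have "\<dots> \<le> b * iter_ln 2 y" using p by (intro mult_right_mono) auto
  finally have "?s \<le> b * iter_ln 2 y" .
  moreover have "(1 + 2 * \<gamma>) * iter_ln (b + 1) y \<le> (1 + 2 * \<gamma>) * iter_ln 2 y"
    using \<gamma> b by (intro mult_left_mono le) auto
  moreover have "iter_ln 3 y \<le> iter_ln 2 y" using b by (intro le) auto
  ultimately show "(psi b \<gamma> y)\<^sup>2 \<le> (7 + 2 * real b + 4 * \<gamma>) * iter_ln 2 y"
    unfolding sq by (simp add: algebra_simps)
  have "(\<Prod>k=1..b - 1. iter_ln k y) = (\<Prod>k=1..b - 1. exp (iter_ln (Suc k) y))"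
    using pos by (intro prod.cong) (auto simp: iter_ln_Suc)
  also have "\<dots> = exp (\<Sum>k=1..b - 1. iter_ln (Suc k) y)"
    by (simp add: exp_sum)
  also have "(\<Sum>k=1..b - 1. iter_ln (Suc k) y) = (\<Sum>k=2..b. iter_ln k y)"
    using b sum.shift_bounds_cl_Suc_ivl[of "\<lambda>k. iter_ln k y" 1 "b - 1"] by (simp add: numeral_2_eq_2)
  also have "\<dots> = iter_ln 2 y + iter_ln 3 y + ?s"
    using b sum.atLeast_Suc_atMost[of 2 b "\<lambda>k. iter_ln k y"]
      sum.atLeast_Suc_atMost[of 3 b "\<lambda>k. iter_ln k y"] by simp
  finally have P: "(\<Prod>k=1..b - 1. iter_ln k y) = exp (iter_ln 2 y + iter_ln 3 y + ?s)" .
  have W: "iter_ln b y powr a = exp (a * iter_ln (b + 1) y)" for a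
    using pos[of b] by (simp add: powr_def iter_ln_Suc)
  have "sqrt (iter_ln 2 y) = iter_ln 2 y powr (1 / 2)"
    using p by (simp add: powr_half_sqrt)
  also have "\<dots> = exp (iter_ln 3 y / 2)"
    using p iter_ln_Suc[of 2 y] by (simp add: powr_def)
  finally show "exp ((psi b \<gamma> y)\<^sup>2 / 2) = sqrt (iter_ln 2 y) * iter_ln b y powr \<gamma> * log_prod b \<gamma> y"
    unfolding sq log_prod_def P W by (simp add: exp_add[symmetric] field_simps)
qed

text \<open>The square of \<open>psi\<close> is at most a constant times
  \<open>ln (A\<^sup>2)\<close>, so its powers are negligible against \<open>A\<close>.\<close>

lemma eventually_psi_small:
  assumes b: "b \<ge> 4" and \<gamma>: "\<gamma> > 0" and d: "d > 0"
  shows "\<forall>\<^sub>F A in at_top. 1 \<le> A \<and> (exp ^^ Suc b) 0 < A\<^sup>2 \<and> 1 \<le> psi b \<gamma> (A\<^sup>2)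
    \<and> (psi b \<gamma> (A\<^sup>2) + 1) ^ 3 / A < d"
proof -
  define C where "C = 7 + 2 * real b + 4 * \<gamma>"
  have C: "0 < C" using \<gamma> by (simp add: C_def)
  have sq: "filterlim (\<lambda>A::real. A\<^sup>2) at_top at_top" by real_asymp
  have 1: "\<forall>\<^sub>F A in at_top. (exp ^^ Suc b) 0 < (A::real)\<^sup>2"
    using sq by (simp add: filterlim_at_top_dense)
  have 2: "\<forall>\<^sub>F A in at_top. 1 \<le> iter_ln 2 (A\<^sup>2)"
    using filterlim_compose[OF filterlim_iter_ln[of 2] sq] by (simp add: filterlim_at_top)
  have "((\<lambda>A. (sqrt (C * ln (A\<^sup>2)) + 1) ^ 3 / A) \<longlongrightarrow> 0) at_top"
    using C by real_asymp
  then have 3: "\<forall>\<^sub>F A in at_top. (sqrt (C * ln (A\<^sup>2)) + 1) ^ 3 / A < d"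
    using d by (rule order_tendstoD(2))
  show ?thesis
    using 1 2 3 eventually_ge_at_top[of 1]
  proof eventually_elim
    case (elim A)
    note bounds = psi_bounds(1,2)[OF b \<gamma> elim(1), folded C_def]
    have "1\<^sup>2 \<le> (psi b \<gamma> (A\<^sup>2))\<^sup>2" using bounds(1) elim(2) by simp
    \<comment> \<open>Isabelle's \<open>sqrt\<close> is odd, so the sign is read off the
      radicand.\<close>
    moreover have p0: "0 \<le> psi b \<gamma> (A\<^sup>2)"
    proof -
      have "0 \<le> iter_ln k (A\<^sup>2)" if "k \<le> Suc b" for k
        using iter_ln_pos[OF elim(1) that] by simp
      then show ?thesis unfolding psi_def using b \<gamma>
        by (intro real_sqrt_ge_zero add_nonneg_nonneg mult_nonneg_nonneg sum_nonneg) auto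
    qed
    ultimately have psi1: "1 \<le> psi b \<gamma> (A\<^sup>2)" using power2_le_imp_le by blast
    have "iter_ln 2 (A\<^sup>2) \<le> iter_ln 1 (A\<^sup>2)"
      using b by (intro iter_ln_antimono[OF elim(1)]) auto
    then have "C * iter_ln 2 (A\<^sup>2) \<le> C * ln (A\<^sup>2)"
      using C by (intro mult_left_mono) (auto simp: iter_ln_Suc[of 0, simplified])
    then have "psi b \<gamma> (A\<^sup>2) \<le> sqrt (C * ln (A\<^sup>2))"
      using bounds(2) by (intro real_le_rsqrt) linarith
    then have "(psi b \<gamma> (A\<^sup>2) + 1) ^ 3 / A \<le> (sqrt (C * ln (A\<^sup>2)) + 1) ^ 3 / A"
      using p0 elim(4) by (intro divide_right_mono power_mono) auto
    then show ?case using elim psi1 by linarith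
  qed
qed

section \<open>Unbounded capital along the crossing times\<close>

theorem proposition4p7:
  fixes b :: nat and \<gamma> \<epsilon>0 :: real
  assumes "b \<ge> 4" and "\<gamma> > 0"
    and "0 < \<epsilon>0" and "\<epsilon>0 < 1"
    and "\<forall>e. 0 < e \<and> e \<le> \<epsilon>0 \<longrightarrow> iter_ln b (1 / e) > 0"
  shows "weakly_forces (bayes_capital0 (prior b \<gamma> \<epsilon>0)) (bayes_bet (prior b \<gamma> \<epsilon>0))
           {x \<in> paths. filterlim (A_norm x) at_top sequentially \<longrightarrow>
              (\<forall>\<^sub>F n in sequentially. S_sum x n - A_norm x n * psi b \<gamma> ((A_norm x n)\<^sup>2) \<le> 0)}"
proof -
  let ?p = "prior b \<gamma> \<epsilon>0"
  have b1: "b \<ge> 1" using assms(1) by simp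
  have T: "(exp ^^ b) 0 < 1 / \<epsilon>0"
    using funpow_exp_less_of_iter_ln_pos[OF assms(3) b1 assms(5)] .
  note ctx = b1 assms(2-4) T
  have hist: "set (history x n) \<subseteq> {-1..}" if "x \<in> paths" for x n
    using that by (auto simp: history_def paths_def)
  have cap: "capital (bayes_capital0 ?p) (bayes_bet ?p) (history x n) = bayes_mixture ?p (history x n)"
    if "x \<in> paths" for x n
    using capital_bayes_bet[OF prior_integrable[OF ctx] bayes_mixture_prior_pos[OF ctx] hist[OF that]] .
  \<comment> \<open>The numerator is the loss within the window; the denominator comes from
    \<open>\<psi> + 1 \<le> 2 * \<psi>\<close> and the upper bound in
    \<open>psi_bounds\<close>.\<close>
  define c where "c = exp (-3/2) / (2 * sqrt (7 + 2 * real b + 4 * \<gamma>))"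
  have c: "0 < c" using assms(2) by (simp add: c_def add_pos_pos)
  have limsup: "limsup (\<lambda>n. ereal (bayes_mixture ?p (history x n))) = \<infinity>"
    if x: "x \<in> paths" and Ainf: "filterlim (A_norm x) at_top sequentially"
      and freq: "\<not> (\<forall>\<^sub>F n in sequentially. S_sum x n - A_norm x n * psi b \<gamma> ((A_norm x n)\<^sup>2) \<le> 0)"
    for x
  proof (rule ccontr)
    \<comment> \<open>A finite limsup keeps the capital eventually below some \<open>B\<close>,
      whereas every late crossing forces it to at least \<open>B\<close>; hence crossings would
      stop.\<close>
    assume "limsup (\<lambda>n. ereal (bayes_mixture ?p (history x n))) \<noteq> \<infinity>"
    then obtain B where "limsup (\<lambda>n. ereal (bayes_mixture ?p (history x n))) < ereal B"
      unfolding less_PInf_Ex_of_nat by blast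
    then have ev: "\<forall>\<^sub>F n in sequentially. bayes_mixture ?p (history x n) < B"
      using Limsup_lessD by fastforce
    have "filterlim (\<lambda>A::real. A\<^sup>2) at_top at_top" by real_asymp
    then have A2: "filterlim (\<lambda>n. (A_norm x n)\<^sup>2) at_top sequentially"
      using filterlim_compose Ainf by blast
    have "filterlim (\<lambda>t::real. c * t powr \<gamma>) at_top at_top" using c assms(2) by real_asymp
    then have "filterlim (\<lambda>n. c * iter_ln b ((A_norm x n)\<^sup>2) powr \<gamma>) at_top sequentially"
      using filterlim_compose filterlim_compose[OF filterlim_iter_ln A2] by blast
    then have big: "\<forall>\<^sub>F n in sequentially. B \<le> c * iter_ln b ((A_norm x n)\<^sup>2) powr \<gamma>"
      by (simp add: filterlim_at_top)
    \<comment> \<open>As \<open>\<psi> + 1 \<ge> 1\<close>, this one bound on the cube over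
      \<open>A\<close> supplies all three smallness conditions of
      \<open>bayes_mixture_history_ge\<close>.\<close>
    have d: "0 < min (1/2) \<epsilon>0" using assms(3) by simp
    have small: "\<forall>\<^sub>F n in sequentially. 1 \<le> A_norm x n \<and> (exp ^^ Suc b) 0 < (A_norm x n)\<^sup>2
        \<and> 1 \<le> psi b \<gamma> ((A_norm x n)\<^sup>2)
        \<and> (psi b \<gamma> ((A_norm x n)\<^sup>2) + 1) ^ 3 / A_norm x n < min (1/2) \<epsilon>0"
      using eventually_compose_filterlim[OF eventually_psi_small[OF assms(1,2) d] Ainf] .
    have "\<forall>\<^sub>F n in sequentially. S_sum x n - A_norm x n * psi b \<gamma> ((A_norm x n)\<^sup>2) \<le> 0"
      using ev big small
    proof eventually_elim
      case (elim n)
      define A where "A = A_norm x n"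
      define \<psi> where "\<psi> = psi b \<gamma> (A\<^sup>2)"
      have A: "1 \<le> A" and y: "(exp ^^ Suc b) 0 < A\<^sup>2" and \<psi>: "1 \<le> \<psi>"
        and r: "(\<psi> + 1) ^ 3 / A < min (1/2) \<epsilon>0"
        using elim by (auto simp: A_def \<psi>_def)
      have y': "(exp ^^ b) 0 < A\<^sup>2"
      proof -
        have "(exp ^^ b) (0::real) \<le> (exp ^^ Suc b) 0"
          using exp_ge_add_one_self[of "(exp ^^ b) (0::real)"] by (simp del: exp_ge_add_one_self)
        then show ?thesis using y by linarith
      qed
      have L2: "0 < iter_ln 2 (A\<^sup>2)" using iter_ln_pos[OF y] assms(1) by simp
      have D: "0 < log_prod b \<gamma> (A\<^sup>2)" using log_prod_pos[OF y'] .
      show ?case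
      proof (rule ccontr)
        assume "\<not> S_sum x n - A_norm x n * psi b \<gamma> ((A_norm x n)\<^sup>2) \<le> 0"
        then have S: "A * \<psi> \<le> S_sum x n" by (simp add: A_def \<psi>_def)
        have "(\<psi> + 1) ^ 1 \<le> (\<psi> + 1) ^ 3" using \<psi> by (intro power_increasing) auto
        then have "(\<psi> + 1) / A \<le> (\<psi> + 1) ^ 3 / A" using A by (intro divide_right_mono) auto
        then have r': "(\<psi> + 1) / A < \<epsilon>0" "(\<psi> + 1) / A \<le> 1 / 2" using r by linarith+
        have r3: "(\<psi> + 1) ^ 3 \<le> A" using r A by (auto simp: field_simps)
        have "\<psi>\<^sup>2 \<le> (7 + 2 * real b + 4 * \<gamma>) * iter_ln 2 (A\<^sup>2)"
          using psi_bounds(2)[OF assms(1,2) y] by (simp add: \<psi>_def)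
        then have "\<psi> \<le> sqrt (7 + 2 * real b + 4 * \<gamma>) * sqrt (iter_ln 2 (A\<^sup>2))"
          by (simp add: real_le_rsqrt flip: real_sqrt_mult)
        then have "\<psi> + 1 \<le> 2 * sqrt (7 + 2 * real b + 4 * \<gamma>) * sqrt (iter_ln 2 (A\<^sup>2))" using \<psi> by linarith
        then have "exp (-3/2) * (\<psi> + 1)
            \<le> exp (-3/2) * (2 * sqrt (7 + 2 * real b + 4 * \<gamma>) * sqrt (iter_ln 2 (A\<^sup>2)))"
          by (intro mult_left_mono) auto
        then have "c * (\<psi> + 1) \<le> exp (-3/2) * sqrt (iter_ln 2 (A\<^sup>2))"
          using assms(2) by (simp add: c_def field_simps add_pos_pos)
        then have "c * (\<psi> + 1) * (iter_ln b (A\<^sup>2) powr \<gamma> * log_prod b \<gamma> (A\<^sup>2))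
            \<le> exp (-3/2) * sqrt (iter_ln 2 (A\<^sup>2)) * (iter_ln b (A\<^sup>2) powr \<gamma> * log_prod b \<gamma> (A\<^sup>2))"
          using D by (intro mult_right_mono) auto
        \<comment> \<open>The square root pays for \<open>\<psi> + 1\<close> and
          \<open>log_prod\<close> for the prior mass; the power \<open>\<gamma>\<close> of
          \<open>iter_ln b\<close> is the surplus that diverges.\<close>
        also have "\<dots> = exp (\<psi>\<^sup>2 / 2 - 3 / 2)"
          using psi_bounds(3)[OF assms(1,2) y] exp_add[of "-3/2" "\<psi>\<^sup>2 / 2"]
          by (simp add: \<psi>_def mult.assoc)
        finally have "c * iter_ln b (A\<^sup>2) powr \<gamma> \<le> exp (\<psi>\<^sup>2 / 2 - 3 / 2) / ((\<psi> + 1) * log_prod b \<gamma> (A\<^sup>2))"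
          using \<psi> D by (subst pos_le_divide_eq) (auto simp: ac_simps)
        also have "\<dots> \<le> bayes_mixture ?p (history x n)"
          by (rule bayes_mixture_history_ge[OF ctx x A_def A S \<psi> r3 r' y'])
        finally show False using elim by (simp add: A_def)
      qed
    qed
    then show False using freq by contradiction
  qed
  show ?thesis
    unfolding weakly_forces_def
  proof (intro conjI ballI allI)
    show "0 < bayes_capital0 ?p"
      using bayes_mixture_prior_pos[OF ctx, of "[]"] by (simp add: bayes_mixture_def bayes_capital0_def)
    show "0 \<le> capital (bayes_capital0 ?p) (bayes_bet ?p) (history x n)" if "x \<in> paths" for x n
      using bayes_mixture_prior_pos[OF ctx hist[OF that]] cap[OF that] by (simp add: less_imp_le)
  qed (use limsup cap in auto)
qed

end
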